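(* Let $H$ be a complex linear space of finite dimension $m$, and let $S=(H;H_1,H_2,\ldots,H_n)$ be a brick collection of one-dimensional subspaces of $H$ (that is, $\dim H_i=1$ for all $i$). Then there exists a character $\chi=(a_0;a_1,\ldots,a_n)$ such that $S$ can be unitarized with the character $\chi$.
   Context: All linear spaces are finite dimensional over $\mathbb{C}$. A collection (system) of subspaces $L=(V;V_1,\ldots,V_n)$ consists of a linear space $V$ and subspaces $V_1,\ldots,V_n\subset V$. It is called brick if every linear operator $X:V\to V$ with $X(V_i)\subset V_i$ for all $i=1,\ldots,n$ is a scalar multiple of the identity. A character is a tuple $\chi=(a_0;a_1,\ldots,a_n)$ of real numbers with $a_0\ge 0$ and $a_k>0$ for $1\le k\le n$. The collection $L$ can be unitarized with the character $\chi$ if $V$ can be endowed with a Hermitian scalar product such that $\sum_{k=1}^n a_kP_k=a_0I$, where $P_k$ is the orthogonal projection of $V$ onto $V_k$ with respect to this scalar product. *)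

theory Defs
  imports Complex_Main
begin

text \<open>The ambient space is a whole type with a complex scalar multiplication \<open>scale\<close>. A collection
  \<open>(V; V\<^sub>1, \<dots>, V\<^sub>n)\<close> is a family \<open>V :: nat \<Rightarrow> 'v set\<close>, of which only the values at \<open>1..n\<close> matter.\<close>

definition subspace_system ::
  "(complex \<Rightarrow> 'v \<Rightarrow> 'v::ab_group_add) \<Rightarrow> nat \<Rightarrow> (nat \<Rightarrow> 'v set) \<Rightarrow> bool" where
  "subspace_system scale n V \<longleftrightarrow> (\<forall>i\<in>{1..n}. module.subspace scale (V i))"

definition brick ::
  "(complex \<Rightarrow> 'v \<Rightarrow> 'v::ab_group_add) \<Rightarrow> nat \<Rightarrow> (nat \<Rightarrow> 'v set) \<Rightarrow> bool" where
  "brick scale n V \<longleftrightarrow>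
     (\<forall>X. Vector_Spaces.linear scale scale X \<and> (\<forall>i\<in>{1..n}. X ` V i \<subseteq> V i)
          \<longrightarrow> (\<exists>c. \<forall>x. X x = scale c x))"

text \<open>Linear in the first argument. By Hermitian symmetry \<open>ip x x\<close> is real, so taking the real
  part in the positivity condition loses nothing.\<close>

definition hermitian_scalar_product ::
  "(complex \<Rightarrow> 'v \<Rightarrow> 'v::ab_group_add) \<Rightarrow> ('v \<Rightarrow> 'v \<Rightarrow> complex) \<Rightarrow> bool" where
  "hermitian_scalar_product scale ip \<longleftrightarrow>
     (\<forall>x y z. ip (x + y) z = ip x z + ip y z) \<and>
     (\<forall>c x y. ip (scale c x) y = c * ip x y) \<and>
     (\<forall>x y. ip y x = cnj (ip x y)) \<and>
     (\<forall>x. x \<noteq> 0 \<longrightarrow> 0 < Re (ip x x))"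

text \<open>For a Hermitian scalar product and a subspace \<open>W\<close> there is at most one such \<open>P\<close>, and
  exactly one if \<open>W\<close> is finite dimensional.\<close>

definition is_orthogonal_projection ::
  "('v \<Rightarrow> 'v \<Rightarrow> complex) \<Rightarrow> 'v::ab_group_add set \<Rightarrow> ('v \<Rightarrow> 'v) \<Rightarrow> bool" where
  "is_orthogonal_projection ip W P \<longleftrightarrow>
     (\<forall>x. P x \<in> W \<and> (\<forall>w\<in>W. ip (x - P x) w = 0))"

text \<open>A character \<open>(a\<^sub>0; a\<^sub>1, \<dots>, a\<^sub>n)\<close> is given by the values of \<open>a\<close> at \<open>0..n\<close>.\<close>

definition is_character :: "nat \<Rightarrow> (nat \<Rightarrow> real) \<Rightarrow> bool" where
  "is_character n a \<longleftrightarrow> 0 \<le> a 0 \<and> (\<forall>k\<in>{1..n}. 0 < a k)"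

definition unitarized_with ::
  "(complex \<Rightarrow> 'v \<Rightarrow> 'v::ab_group_add) \<Rightarrow> nat \<Rightarrow> (nat \<Rightarrow> 'v set) \<Rightarrow> (nat \<Rightarrow> real) \<Rightarrow> bool" where
  "unitarized_with scale n V a \<longleftrightarrow>
     (\<exists>ip P. hermitian_scalar_product scale ip \<and>
             (\<forall>k\<in>{1..n}. is_orthogonal_projection ip (V k) (P k)) \<and>
             (\<forall>x. (\<Sum>k=1..n. scale (complex_of_real (a k)) (P k x))
                    = scale (complex_of_real (a 0)) x))"

end

theory Submission imports Defs begin

text \<open>
  Pick a nonzero vector \<open>v\<^sub>k\<close> on each line. The orthogonal projection onto that line is
  \<open>x \<mapsto> \<langle>x, v\<^sub>k\<rangle> / \<langle>v\<^sub>k, v\<^sub>k\<rangle> \<sqdot> v\<^sub>k\<close>, so with the weights \<open>a\<^sub>k = \<langle>v\<^sub>k, v\<^sub>k\<rangle>\<close> and \<open>a\<^sub>0 = 1\<close> the required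
  identity becomes \<open>\<Sum>\<^sub>k \<langle>x, v\<^sub>k\<rangle> v\<^sub>k = x\<close>: the scalar product has to make the \<open>v\<^sub>k\<close> a Parseval frame.
  Every finite spanning family is a Parseval frame for a suitable scalar product
  (\<open>spanning_family_parseval\<close>): start from any scalar product, and twist it by the inverse of
  the frame operator \<open>S x = \<Sum>\<^sub>k \<langle>x, v\<^sub>k\<rangle> v\<^sub>k\<close>, which is positive definite.

  The brick property enters only to show that the lines span (\<open>brick_spans\<close>): if they did not, a
  nonzero operator vanishing on their span would preserve each line without being a scalar. This step
  needs a nonzero vector in the span. An empty system has none, but it is unitarized by any scalar
  product with \<open>a\<^sub>0 = 0\<close>.
\<close>

locale complex_fd_space = finite_dimensional_vector_space scale Basis
  for scale :: "complex \<Rightarrow> 'v \<Rightarrow> 'v::ab_group_add" (infixr \<open>*s\<close> 75) and Basis :: "'v set"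
begin

lemma hermitian_scalar_product_exists: "\<exists>ip. hermitian_scalar_product scale ip"
proof -
  define r where "r = representation Basis"
  define ip where "ip x y = (\<Sum>b\<in>Basis. r x b * cnj (r y b))" for x y
  have ind: "independent Basis" and fin: "finite Basis" and sp: "x \<in> span Basis" for x
    using independent_Basis finite_Basis span_Basis by auto
  have r_add: "r (x + y) b = r x b + r y b" for x y b
    unfolding r_def by (simp add: representation_add[OF ind sp sp])
  have r_scale: "r (c *s x) b = c * r x b" for c x b
    unfolding r_def by (simp add: representation_scale[OF ind sp])
  have pos: "0 < Re (ip x x)" if "x \<noteq> 0" for x
  proof -
    have "\<exists>b\<in>Basis. r x b \<noteq> 0"
    proof (rule ccontr)
      assume "\<not> (\<exists>b\<in>Basis. r x b \<noteq> 0)"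
      then have "(\<Sum>b\<in>Basis. r x b *s b) = 0" by simp
      then show False
        using sum_representation_eq[OF ind sp fin order_refl, of x] that by (simp add: r_def)
    qed
    moreover have "Re (ip x x) = (\<Sum>b\<in>Basis. (cmod (r x b))\<^sup>2)"
      by (simp add: ip_def complex_norm_square[symmetric] del: of_real_power)
    ultimately show ?thesis
      using fin by (auto intro: sum_pos2)
  qed
  have "hermitian_scalar_product scale ip"
    unfolding hermitian_scalar_product_def
  proof (intro conjI allI impI)
    show "ip (x + y) z = ip x z + ip y z" for x y z
      by (simp add: ip_def r_add distrib_right sum.distrib)
    show "ip (c *s x) y = c * ip x y" for c x y
      by (simp add: ip_def r_scale sum_distrib_left mult.assoc)
    show "ip y x = cnj (ip x y)" for x y
      by (simp add: ip_def mult.commute)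
  qed (rule pos)
  then show ?thesis by blast
qed

text \<open>With \<open>S\<close> the frame operator of an arbitrary scalar product \<open>ip0\<close>, the new product is
  \<open>ip0 (S\<inverse> x) y\<close>: its frame operator at \<open>x\<close> is that of \<open>ip0\<close> at \<open>S\<inverse> x\<close>, which is \<open>S (S\<inverse> x) = x\<close>.
  Spanning makes \<open>S\<close> positive definite; this gives both the inverse and the positivity.\<close>

lemma spanning_family_parseval:
  fixes v :: "'i \<Rightarrow> 'v"
  assumes I: "finite I" and span: "span (v ` I) = UNIV"
  obtains ip where "hermitian_scalar_product scale ip"
    and "\<And>x. (\<Sum>i\<in>I. ip x (v i) *s v i) = x"
proof -
  obtain ip0 where ip0: "hermitian_scalar_product scale ip0"
    using hermitian_scalar_product_exists by blast
  have add: "ip0 (x + y) z = ip0 x z + ip0 y z" and scl: "ip0 (c *s x) y = c * ip0 x y"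
    and sym: "ip0 y x = cnj (ip0 x y)" and pos: "x \<noteq> 0 \<Longrightarrow> 0 < Re (ip0 x x)" for x y z c
    using ip0 unfolding hermitian_scalar_product_def by blast+
  interpret pair: vector_space_pair scale scale ..
  interpret left: Vector_Spaces.linear scale "(*)" "\<lambda>x. ip0 x y" for y
    by unfold_locales (simp_all add: add scl algebra_simps)
  define S where "S x = (\<Sum>i\<in>I. ip0 x (v i) *s v i)" for x
  \<comment> \<open>The sesquilinear form of the frame operator, written so that its symmetry is apparent.\<close>
  define Q where "Q x y = (\<Sum>i\<in>I. ip0 x (v i) * cnj (ip0 y (v i)))" for x y
  have Q: "ip0 (S x) y = Q x y" for x y
  proof -
    have "ip0 (S x) y = (\<Sum>i\<in>I. ip0 (ip0 x (v i) *s v i) y)"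
      unfolding S_def by (rule left.sum)
    also have "\<dots> = Q x y"
      unfolding Q_def by (intro sum.cong) (simp_all add: scl sym[where y = "v _" and x = y])
    finally show ?thesis .
  qed
  have Q_sym: "Q y x = cnj (Q x y)" for x y
    by (simp add: Q_def mult.commute)
  have Q_pos: "0 < Re (Q x x)" if "x \<noteq> 0" for x
  proof -
    \<comment> \<open>A vector orthogonal to the whole family is orthogonal to its span, hence to itself.\<close>
    have "\<exists>i\<in>I. ip0 x (v i) \<noteq> 0"
    proof (rule ccontr)
      assume "\<not> (\<exists>i\<in>I. ip0 x (v i) \<noteq> 0)"
      then have "ip0 w x = 0" if "w \<in> v ` I" for w
        using that sym[where x = x and y = w] by auto
      then have "ip0 x x = 0"
        using left.eq_0_on_span[of "v ` I"] span by blast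
      then show False using pos[OF that] by simp
    qed
    moreover have "Re (Q x x) = (\<Sum>i\<in>I. (cmod (ip0 x (v i)))\<^sup>2)"
      by (simp add: Q_def complex_norm_square[symmetric] del: of_real_power)
    ultimately show ?thesis
      using I by (auto intro: sum_pos2)
  qed
  have lin_S: "Vector_Spaces.linear scale scale S"
    by unfold_locales
      (simp_all add: S_def add scl scale_left_distrib sum.distrib scale_sum_right)
  have "inj S"
  proof (rule pair.linear_inj_iff_eq_0[OF lin_S, THEN iffD2], intro allI impI)
    fix x assume "S x = 0"
    then have "Q x x = 0"
      using Q[of x x] scl[of 0 0 x] by simp
    then show "x = 0" using Q_pos[of x] by fastforce
  qed
  then obtain T where lin_T: "Vector_Spaces.linear scale scale T" and "T \<circ> S = id"
    using pair.linear_injective_left_inverse[OF lin_S] by blast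
  then have TS: "T (S x) = x" for x by (metis comp_apply id_apply)
  have ST: "S (T x) = x" for x
    using linear_inj_imp_surj[OF lin_S \<open>inj S\<close>] TS by (metis surjD)
  \<comment> \<open>The twisted form \<open>ip0 (T x) y\<close> equals \<open>Q (T x) (T y)\<close>, hence is Hermitian and positive.\<close>
  define ip where "ip x y = ip0 (T x) y" for x y
  have ip_Q: "ip x y = Q (T x) (T y)" for x y
    using Q[of "T y" "T x"] sym[where x = y and y = "T x"] Q_sym[where x = "T y" and y = "T x"]
    by (simp add: ip_def ST)
  have T0: "T x \<noteq> 0" if "x \<noteq> 0" for x
    using that ST[of x] pair.linear_0[OF lin_S] by auto
  have "hermitian_scalar_product scale ip"
    unfolding hermitian_scalar_product_def
  proof (intro conjI allI impI)
    show "ip (x + y) z = ip x z + ip y z" for x y z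
      by (simp add: ip_def pair.linear_add[OF lin_T] add)
    show "ip (c *s x) y = c * ip x y" for c x y
      by (simp add: ip_def pair.linear_scale[OF lin_T] scl)
    show "ip y x = cnj (ip x y)" for x y
      unfolding ip_Q by (rule Q_sym)
    show "0 < Re (ip x x)" if "x \<noteq> 0" for x
      unfolding ip_Q by (rule Q_pos[OF T0[OF that]])
  qed
  moreover have "(\<Sum>i\<in>I. ip x (v i) *s v i) = x" for x
    using ST[of x] by (simp add: S_def ip_def)
  ultimately show thesis by (rule that)
qed

text \<open>An operator that vanishes on the span \<open>W\<close> maps each \<open>V i\<close> to \<open>0\<close>, so it is a scalar, and the
  scalar is \<open>0\<close> because it kills \<open>u\<close>. Outside \<open>W\<close> there is thus no room for a vector \<open>w\<close>: a linear
  operator could vanish on \<open>W\<close> and fix \<open>w\<close>.\<close>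

lemma brick_spans:
  assumes brick: "brick scale n V" and k: "k \<in> {1..n}" and u: "u \<in> V k" "u \<noteq> 0"
    and zero: "\<And>i. i \<in> {1..n} \<Longrightarrow> 0 \<in> V i"
  shows "span (\<Union>i\<in>{1..n}. V i) = UNIV"
proof (rule ccontr)
  let ?W = "span (\<Union>i\<in>{1..n}. V i)"
  assume "?W \<noteq> UNIV"
  then obtain w where w: "w \<notin> ?W" by blast
  interpret pair: vector_space_pair scale scale ..
  obtain B where "B \<subseteq> ?W" and B: "independent B" and "?W \<subseteq> span B"
    by (rule basis_exists[of ?W])
  then have B_span: "span B = ?W"
    by (metis span_minimal subspace_span subset_antisym)
  have "independent (insert w B)"
    using w B B_span by (simp add: independent_insertI)
  then obtain X where X: "Vector_Spaces.linear scale scale X"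
    and X_B: "\<forall>x\<in>insert w B. X x = (if x = w then w else 0)"
    using pair.linear_independent_extend[of "insert w B" "\<lambda>x. if x = w then w else 0"] by blast
  have "w \<notin> B" using w B_span span_base by blast
  have X_W: "X x = 0" if "x \<in> ?W" for x
  proof (rule pair.linear_eq_0_on_span[OF X])
    show "X b = 0" if "b \<in> B" for b
      using X_B that \<open>w \<notin> B\<close> by auto
    show "x \<in> span B"
      unfolding B_span by (rule that)
  qed
  have V_W: "V i \<subseteq> ?W" if "i \<in> {1..n}" for i
    using that span_superset by blast
  have "X ` V i \<subseteq> V i" if "i \<in> {1..n}" for i
    using V_W[OF that] X_W zero[OF that] by (metis image_subsetI subsetD)
  then obtain c where c: "\<And>x. X x = c *s x"
    using brick X unfolding brick_def by blast
  have "c *s u = 0"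
    using X_W[of u] c[of u] u(1) V_W[OF k] by auto
  then have "X w = 0" using u c by simp
  then show False using X_B w span_zero by auto
qed

lemma is_orthogonal_projection_line:
  assumes ip: "hermitian_scalar_product scale ip" and u: "u \<noteq> 0"
  shows "is_orthogonal_projection ip (span {u}) (\<lambda>x. (ip x u / ip u u) *s u)"
proof -
  have add: "ip (x + y) z = ip x z + ip y z" and scl: "ip (c *s x) y = c * ip x y"
    and sym: "ip y x = cnj (ip x y)" and pos: "x \<noteq> 0 \<Longrightarrow> 0 < Re (ip x x)" for x y z c
    using ip unfolding hermitian_scalar_product_def by blast+
  have nz: "ip u u \<noteq> 0" using pos[OF u] by auto
  have "ip (x - (ip x u / ip u u) *s u) (c *s u) = 0" for x c
  proof -
    have "ip (x - (ip x u / ip u u) *s u) u = 0"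
      using add[of "x - (ip x u / ip u u) *s u" "(ip x u / ip u u) *s u" u] nz by (simp add: scl)
    then show ?thesis
      using sym[where y = "x - (ip x u / ip u u) *s u" and x = "c *s u"]
        sym[where y = u and x = "x - (ip x u / ip u u) *s u"]
      by (simp add: scl)
  qed
  then show ?thesis
    unfolding is_orthogonal_projection_def by (auto simp: span_singleton)
qed

lemma unitarizable_lines:
  assumes v: "\<And>k. k \<in> {1..n} \<Longrightarrow> v k \<noteq> 0" and span: "span (v ` {1..n}) = UNIV"
    and V: "\<And>k. k \<in> {1..n} \<Longrightarrow> V k = span {v k}"
  shows "\<exists>a. is_character n a \<and> unitarized_with scale n V a"
proof -
  obtain ip where ip: "hermitian_scalar_product scale ip"
    and frame: "\<And>x. (\<Sum>k=1..n. ip x (v k) *s v k) = x"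
    using spanning_family_parseval[OF _ span] by auto
  define a where "a k = (if k = 0 then 1 else Re (ip (v k) (v k)))" for k
  have pos: "0 < Re (ip (v k) (v k))" if "k \<in> {1..n}" for k
    using ip v[OF that] unfolding hermitian_scalar_product_def by blast
  have a: "complex_of_real (a k) = ip (v k) (v k)" "ip (v k) (v k) \<noteq> 0" if "k \<in> {1..n}" for k
  proof -
    have "ip (v k) (v k) = cnj (ip (v k) (v k))"
      using ip unfolding hermitian_scalar_product_def by blast
    then have "Im (ip (v k) (v k)) = 0"
      by (metis Reals_cnj_iff complex_is_Real_iff)
    then show "complex_of_real (a k) = ip (v k) (v k)"
      using that by (simp add: a_def complex_eq_iff)
    show "ip (v k) (v k) \<noteq> 0" using pos[OF that] by auto
  qed
  let ?P = "\<lambda>k x. (ip x (v k) / ip (v k) (v k)) *s v k"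
  have "(\<Sum>k=1..n. complex_of_real (a k) *s ?P k x) = x" for x
  proof -
    have "(\<Sum>k=1..n. complex_of_real (a k) *s ?P k x) = (\<Sum>k=1..n. ip x (v k) *s v k)"
      by (intro sum.cong) (simp_all add: a)
    then show ?thesis using frame by simp
  qed
  then have "unitarized_with scale n V a"
    unfolding unitarized_with_def
    using ip is_orthogonal_projection_line[OF ip v] V
    by (intro exI[of _ ip] exI[of _ ?P]) (auto simp: a_def)
  moreover have "is_character n a"
    using pos by (auto simp: is_character_def a_def)
  ultimately show ?thesis by blast
qed

lemma one_dimensional_subspace:
  assumes "subspace W" "dim W = 1"
  obtains u where "u \<noteq> 0" "W = span {u}"
proof -
  obtain B where B: "B \<subseteq> W" "independent B" "W \<subseteq> span B" "card B = dim W"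
    using basis_exists by blast
  then obtain u where u: "B = {u}"
    using assms(2) card_1_singletonE by metis
  then have "u \<noteq> 0" using B(2) dependent_zero by auto
  moreover have "W = span {u}"
    using B u span_minimal[OF _ assms(1)] by blast
  ultimately show thesis by (rule that)
qed

end

theorem theorem1:
  fixes scale :: "complex \<Rightarrow> 'v \<Rightarrow> 'v::ab_group_add"
    and Basis :: "'v set"
    and H :: "nat \<Rightarrow> 'v set"
    and m n :: nat
  assumes "finite_dimensional_vector_space scale Basis"
    and "vector_space.dim scale (UNIV :: 'v set) = m"
    and "subspace_system scale n H"
    and "\<forall>i\<in>{1..n}. vector_space.dim scale (H i) = 1"
    and "brick scale n H"
  shows "\<exists>a. is_character n a \<and> unitarized_with scale n H a"
proof -
  interpret complex_fd_space scale Basis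
    using assms(1) by (rule complex_fd_space.intro)
  show ?thesis
  proof (cases "n = 0")
    case True
    obtain ip where "hermitian_scalar_product scale ip"
      using hermitian_scalar_product_exists by blast
    then have "is_character n (\<lambda>_. 0)" "unitarized_with scale n H (\<lambda>_. 0)"
      using True by (auto simp: is_character_def unitarized_with_def)
    then show ?thesis by blast
  next
    case False
    have sub: "subspace (H k)" if "k \<in> {1..n}" for k
      using assms(3) that by (simp add: subspace_system_def)
    have "\<exists>u. u \<noteq> 0 \<and> H k = span {u}" if "k \<in> {1..n}" for k
      using one_dimensional_subspace[OF sub[OF that]] assms(4) that by metis
    then obtain v where v: "\<And>k. k \<in> {1..n} \<Longrightarrow> v k \<noteq> 0"
      and H: "\<And>k. k \<in> {1..n} \<Longrightarrow> H k = span {v k}"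
      by metis
    have "span (\<Union>k\<in>{1..n}. H k) = UNIV"
      using brick_spans[OF assms(5), of n "v n"] v H sub False
      by (simp add: span_base subspace_0)
    moreover have "(\<Union>k\<in>{1..n}. H k) \<subseteq> span (v ` {1..n})"
      using H by (auto intro: span_mono[THEN subsetD, rotated])
    ultimately have "span (v ` {1..n}) = UNIV"
      using span_minimal subspace_span by blast
    then show ?thesis
      using unitarizable_lines v H by blast
  qed
qed

end
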